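(* Let $\mathcal M=(\mathcal S,\Theta,\vec\pi)$ be a finite statistical model, $H_0\subseteq\Theta$, $h_1\in\Theta\setminus H_0$, and let $\Lambda$ be a probability distribution over $H_0$. Then $\Lambda$ is a uniformly least favorable distribution for $H_0$ vs. $h_1$ if and only if for every $h_0^*\in\mathrm{Spt}(\Lambda)$ and every $h_0\in H_0$, the random variable $X_{h_0^*}^\Lambda$ weakly dominates $X_{h_0}^\Lambda$.
   Context: A statistical model $(\mathcal S,\Theta,\vec\pi)$ consists of a sample space $\mathcal S$, a parameter space $\Theta$ and probability distributions $\pi_\theta$ on $\mathcal S$ for $\theta\in\Theta$; it is finite if $\mathcal S$ and $\Theta$ are finite. A (randomized) test is a function $f:\mathcal S\to[0,1]$; $\mathrm{Size}(f,h_0)=E_{P\sim\pi_{h_0}}f(P)$, $\mathrm{Size}(f)=\sup_{h_0\in H_0}\mathrm{Size}(f,h_0)$, $\mathrm{Power}(f,h_1)=E_{P\sim\pi_{h_1}}f(P)$. A level-$\alpha$ most powerful test for $H_0$ vs. $h_1$ is a test of size $\alpha$ whose power at $h_1$ is maximal among all tests of size at most $\alpha$. $\mathrm{Spt}(\Lambda)$ is the support of $\Lambda$. Let $\mathrm{Ratio}_{\Lambda,h_1}(P)=\dfrac{\pi_{h_1}(P)}{\sum_{h_0\in H_0}\Lambda(h_0)\pi_{h_0}(P)}$, assumed to be a well-defined positive real number for every $P\in\mathcal S$ (numerator and denominator positive). For $0<\alpha<1$ the likelihood ratio test $\mathrm{LR}_{\alpha,\Lambda,h_1}(P)$ equals $1$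 if $\mathrm{Ratio}_{\Lambda,h_1}(P)>k_\alpha$, $0$ if $\mathrm{Ratio}_{\Lambda,h_1}(P)<k_\alpha$, and $\gamma_\alpha$ if equality holds, where $k_\alpha\ge0$ and $\gamma_\alpha\in[0,1]$ are chosen so that $\sum_{h_0\in H_0}\Lambda(h_0)\,\mathrm{Size}(\mathrm{LR}_{\alpha,\Lambda,h_1},h_0)=\alpha$. $\Lambda$ is a (level-$\alpha$) least favorable distribution for $H_0$ vs. $h_1$ if $\mathrm{LR}_{\alpha,\Lambda,h_1}$ is a level-$\alpha$ most powerful test for $H_0$ vs. $h_1$; by a known result this is equivalent to: (i) $\mathrm{Size}(\mathrm{LR}_{\alpha,\Lambda,h_1},h_0^* )=\alpha$ for all $h_0^*\in\mathrm{Spt}(\Lambda)$ and (ii) $\mathrm{Size}(\mathrm{LR}_{\alpha,\Lambda,h_1},h_0)\le\alpha$ for all $h_0\in H_0$. $\Lambda$ is uniformly least favorable if this holds for all $0<\alpha<1$. For $h_0\in H_0$, $X_{h_0}^\Lambda:\mathcal S\to\mathbb R$ is the random variable $X_{h_0}^\Lambda(P)=\log\mathrm{Ratio}_{\Lambda,h_1}(P)$, where $P$ is distributed according to $\pi_{h_0}$. A random variable $X$ weakly (first-order stochastically) dominates $Y$ if $\Pr(X\ge p)\ge\Pr(Y\ge p)$ for all $p\in\mathbb R$. *)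

theory Defs
  imports "HOL-Probability.Probability"
begin

(* Since S is finite, a probability distribution on S is a pmf supported in S. *)
definition finite_statistical_model :: "'s set \<Rightarrow> 't set \<Rightarrow> ('t \<Rightarrow> 's pmf) \<Rightarrow> bool" where
  "finite_statistical_model S \<Theta> \<pi> \<longleftrightarrow>
     finite S \<and> finite \<Theta> \<and> (\<forall>\<theta>\<in>\<Theta>. set_pmf (\<pi> \<theta>) \<subseteq> S)"

(* Only the values of f on S matter; f is arbitrary elsewhere. *)
definition is_test :: "'s set \<Rightarrow> ('s \<Rightarrow> real) \<Rightarrow> bool" where
  "is_test S f \<longleftrightarrow> (\<forall>P\<in>S. f P \<in> {0..1})"

definition size_at :: "('t \<Rightarrow> 's pmf) \<Rightarrow> ('s \<Rightarrow> real) \<Rightarrow> 't \<Rightarrow> real" where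
  "size_at \<pi> f h\<^sub>0 = measure_pmf.expectation (\<pi> h\<^sub>0) f"

definition test_size :: "('t \<Rightarrow> 's pmf) \<Rightarrow> 't set \<Rightarrow> ('s \<Rightarrow> real) \<Rightarrow> real" where
  "test_size \<pi> H\<^sub>0 f = (SUP h\<^sub>0\<in>H\<^sub>0. size_at \<pi> f h\<^sub>0)"

definition power_at :: "('t \<Rightarrow> 's pmf) \<Rightarrow> ('s \<Rightarrow> real) \<Rightarrow> 't \<Rightarrow> real" where
  "power_at \<pi> f h\<^sub>1 = measure_pmf.expectation (\<pi> h\<^sub>1) f"

definition most_powerful ::
  "'s set \<Rightarrow> ('t \<Rightarrow> 's pmf) \<Rightarrow> 't set \<Rightarrow> 't \<Rightarrow> real \<Rightarrow> ('s \<Rightarrow> real) \<Rightarrow> bool" where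
  "most_powerful S \<pi> H\<^sub>0 h\<^sub>1 \<alpha> f \<longleftrightarrow>
     is_test S f \<and> test_size \<pi> H\<^sub>0 f = \<alpha> \<and>
     (\<forall>g. is_test S g \<and> test_size \<pi> H\<^sub>0 g \<le> \<alpha> \<longrightarrow> power_at \<pi> g h\<^sub>1 \<le> power_at \<pi> f h\<^sub>1)"

definition mixture :: "('t \<Rightarrow> 's pmf) \<Rightarrow> 't set \<Rightarrow> 't pmf \<Rightarrow> 's \<Rightarrow> real" where
  "mixture \<pi> H\<^sub>0 \<Lambda> P = (\<Sum>h\<^sub>0\<in>H\<^sub>0. pmf \<Lambda> h\<^sub>0 * pmf (\<pi> h\<^sub>0) P)"

definition Ratio :: "('t \<Rightarrow> 's pmf) \<Rightarrow> 't set \<Rightarrow> 't pmf \<Rightarrow> 't \<Rightarrow> 's \<Rightarrow> real" where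
  "Ratio \<pi> H\<^sub>0 \<Lambda> h\<^sub>1 P = pmf (\<pi> h\<^sub>1) P / mixture \<pi> H\<^sub>0 \<Lambda> P"

definition threshold_test :: "('s \<Rightarrow> real) \<Rightarrow> real \<times> real \<Rightarrow> 's \<Rightarrow> real" where
  "threshold_test R = (\<lambda>(k, \<gamma>) P. if R P > k then 1 else if R P < k then 0 else \<gamma>)"

definition LR_params ::
  "('t \<Rightarrow> 's pmf) \<Rightarrow> 't set \<Rightarrow> 't pmf \<Rightarrow> 't \<Rightarrow> real \<Rightarrow> real \<times> real \<Rightarrow> bool" where
  "LR_params \<pi> H\<^sub>0 \<Lambda> h\<^sub>1 \<alpha> = (\<lambda>(k, \<gamma>). k \<ge> 0 \<and> \<gamma> \<in> {0..1} \<and>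
     (\<Sum>h\<^sub>0\<in>H\<^sub>0. pmf \<Lambda> h\<^sub>0 * size_at \<pi> (threshold_test (Ratio \<pi> H\<^sub>0 \<Lambda> h\<^sub>1) (k, \<gamma>)) h\<^sub>0) = \<alpha>)"

(* Admissible parameters exist (LR_params_exist), and any two choices yield the same
   test on S (LR_params_unique), so it is immaterial which ones are selected. *)
definition LR ::
  "('t \<Rightarrow> 's pmf) \<Rightarrow> 't set \<Rightarrow> 't pmf \<Rightarrow> 't \<Rightarrow> real \<Rightarrow> 's \<Rightarrow> real" where
  "LR \<pi> H\<^sub>0 \<Lambda> h\<^sub>1 \<alpha> =
     threshold_test (Ratio \<pi> H\<^sub>0 \<Lambda> h\<^sub>1) (SOME k\<gamma>. LR_params \<pi> H\<^sub>0 \<Lambda> h\<^sub>1 \<alpha> k\<gamma>)"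

definition least_favorable ::
  "'s set \<Rightarrow> ('t \<Rightarrow> 's pmf) \<Rightarrow> 't set \<Rightarrow> 't \<Rightarrow> real \<Rightarrow> 't pmf \<Rightarrow> bool" where
  "least_favorable S \<pi> H\<^sub>0 h\<^sub>1 \<alpha> \<Lambda> \<longleftrightarrow> most_powerful S \<pi> H\<^sub>0 h\<^sub>1 \<alpha> (LR \<pi> H\<^sub>0 \<Lambda> h\<^sub>1 \<alpha>)"

definition uniformly_least_favorable ::
  "'s set \<Rightarrow> ('t \<Rightarrow> 's pmf) \<Rightarrow> 't set \<Rightarrow> 't \<Rightarrow> 't pmf \<Rightarrow> bool" where
  "uniformly_least_favorable S \<pi> H\<^sub>0 h\<^sub>1 \<Lambda> \<longleftrightarrow>
     (\<forall>\<alpha>. 0 < \<alpha> \<and> \<alpha> < 1 \<longrightarrow> least_favorable S \<pi> H\<^sub>0 h\<^sub>1 \<alpha> \<Lambda>)"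

definition log_ratio :: "('t \<Rightarrow> 's pmf) \<Rightarrow> 't set \<Rightarrow> 't pmf \<Rightarrow> 't \<Rightarrow> 's \<Rightarrow> real" where
  "log_ratio \<pi> H\<^sub>0 \<Lambda> h\<^sub>1 P = ln (Ratio \<pi> H\<^sub>0 \<Lambda> h\<^sub>1 P)"

(* X on the probability space M dominates Y on the probability space N. *)
definition weakly_dominates ::
  "'a measure \<Rightarrow> ('a \<Rightarrow> real) \<Rightarrow> 'b measure \<Rightarrow> ('b \<Rightarrow> real) \<Rightarrow> bool" where
  "weakly_dominates M X N Y \<longleftrightarrow>
     (\<forall>p. measure M {w \<in> space M. X w \<ge> p} \<ge> measure N {w \<in> space N. Y w \<ge> p})"

lemma mixture_size:
  assumes "finite S" "finite H\<^sub>0" "\<forall>h\<in>H\<^sub>0. set_pmf (\<pi> h) \<subseteq> S"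
  shows "(\<Sum>h\<in>H\<^sub>0. pmf \<Lambda> h * size_at \<pi> f h) = (\<Sum>P\<in>S. mixture \<pi> H\<^sub>0 \<Lambda> P * f P)"
proof -
  have "size_at \<pi> f h = (\<Sum>P\<in>S. f P * pmf (\<pi> h) P)" if "h \<in> H\<^sub>0" for h
    unfolding size_at_def using assms that
    by (intro integral_measure_pmf_real) auto
  then have "(\<Sum>h\<in>H\<^sub>0. pmf \<Lambda> h * size_at \<pi> f h)
      = (\<Sum>h\<in>H\<^sub>0. \<Sum>P\<in>S. pmf \<Lambda> h * pmf (\<pi> h) P * f P)"
    by (intro sum.cong) (auto simp: sum_distrib_left algebra_simps)
  also have "\<dots> = (\<Sum>P\<in>S. \<Sum>h\<in>H\<^sub>0. pmf \<Lambda> h * pmf (\<pi> h) P * f P)"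
    by (rule sum.swap)
  finally show ?thesis by (simp add: mixture_def sum_distrib_right)
qed

lemma sum_mixture:
  assumes "finite S" "finite H\<^sub>0" "\<forall>h\<in>H\<^sub>0. set_pmf (\<pi> h) \<subseteq> S" "set_pmf \<Lambda> \<subseteq> H\<^sub>0"
  shows "(\<Sum>P\<in>S. mixture \<pi> H\<^sub>0 \<Lambda> P) = 1"
proof -
  have "(\<Sum>P\<in>S. mixture \<pi> H\<^sub>0 \<Lambda> P) = (\<Sum>h\<in>H\<^sub>0. pmf \<Lambda> h * size_at \<pi> (\<lambda>_. 1) h)"
    using mixture_size[OF assms(1-3), of \<Lambda> "\<lambda>_. 1"] by simp
  also have "\<dots> = 1"
    using assms(2,4) by (simp add: size_at_def sum_pmf_eq_1)
  finally show ?thesis .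
qed

lemma LR_params_exist:
  assumes fin: "finite S" "finite H\<^sub>0" "\<forall>h\<in>H\<^sub>0. set_pmf (\<pi> h) \<subseteq> S" "set_pmf \<Lambda> \<subseteq> H\<^sub>0"
    and pos: "\<forall>P\<in>S. pmf (\<pi> h\<^sub>1) P > 0 \<and> mixture \<pi> H\<^sub>0 \<Lambda> P > 0"
    and \<alpha>: "0 < \<alpha>" "\<alpha> < 1"
  shows "\<exists>k\<gamma>. LR_params \<pi> H\<^sub>0 \<Lambda> h\<^sub>1 \<alpha> k\<gamma>"
proof -
  define m where "m = mixture \<pi> H\<^sub>0 \<Lambda>"
  define R where "R = Ratio \<pi> H\<^sub>0 \<Lambda> h\<^sub>1"
  define A where "A k = sum m {P\<in>S. R P \<ge> k}" for k
  define B where "B k = sum m {P\<in>S. R P > k}" for k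
  have m1: "sum m S = 1" using sum_mixture[OF fin] by (simp add: m_def)
  then have ne: "S \<noteq> {}" by auto
  have Rpos: "R P > 0" if "P \<in> S" for P using pos that by (auto simp: R_def Ratio_def)
  have mpos: "m P > 0" if "P \<in> S" for P using pos that by (auto simp: m_def)
  define K where "K = {k \<in> R ` S. A k \<ge> \<alpha>}"
  have finK: "finite K" using fin by (simp add: K_def)
  have "A (Min (R ` S)) = 1"
    unfolding A_def using fin m1 by (subst m1[symmetric], intro sum.cong) auto
  then have "Min (R ` S) \<in> K" using \<alpha> ne fin by (auto simp: K_def intro!: Min_in)
  then have neK: "K \<noteq> {}" by auto
  define k where "k = Max K"
  have kK: "k \<in> K" using finK neK by (simp add: k_def)
  have Ak: "A k \<ge> \<alpha>" using kK by (simp add: K_def)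
  have Bk: "B k < \<alpha>"
  proof (cases "{P\<in>S. R P > k} = {}")
    case True then show ?thesis using \<alpha> unfolding B_def by (simp only: sum.empty)
  next
    case False
    define k' where "k' = Min (R ` {P\<in>S. R P > k})"
    have k': "k' \<in> R ` {P\<in>S. R P > k}" unfolding k'_def using False fin by (intro Min_in) auto
    have "k' \<le> R P" if "P \<in> S" "R P > k" for P
      unfolding k'_def using that fin by (intro Min_le) auto
    then have "B k = A k'" unfolding A_def B_def using k' by (intro sum.cong) force+
    moreover have "k' \<notin> K" using k' Max_ge[OF finK, of k'] by (auto simp: k_def)
    ultimately show ?thesis using k' by (auto simp: K_def)
  qed
  define \<gamma> where "\<gamma> = (\<alpha> - B k) / (A k - B k)"
  have \<gamma>: "\<gamma> \<in> {0..1}" using Ak Bk by (auto simp: \<gamma>_def field_simps)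
  have AB: "A k = B k + sum m {P\<in>S. R P = k}"
  proof -
    have "{P\<in>S. R P \<ge> k} = {P\<in>S. R P > k} \<union> {P\<in>S. R P = k}" by auto
    then show ?thesis unfolding A_def B_def using fin by (subst sum.union_disjoint[symmetric]) auto
  qed
  have "(\<Sum>P\<in>S. m P * threshold_test R (k, \<gamma>) P)
      = (\<Sum>P\<in>S. (if R P > k then m P else 0) + \<gamma> * (if R P = k then m P else 0))"
    by (intro sum.cong) (auto simp: threshold_test_def)
  also have "\<dots> = B k + \<gamma> * (A k - B k)"
    using fin by (simp add: AB sum.distrib sum_distrib_left[symmetric] sum.inter_filter B_def)
  also have "\<dots> = \<alpha>" using Ak Bk by (simp add: \<gamma>_def)
  finally have "(\<Sum>h\<in>H\<^sub>0. pmf \<Lambda> h * size_at \<pi> (threshold_test R (k, \<gamma>)) h) = \<alpha>"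
    by (simp add: mixture_size[OF fin(1-3)] m_def)
  moreover have "k \<ge> 0" using kK Rpos by (auto simp: K_def intro: less_imp_le)
  ultimately have "LR_params \<pi> H\<^sub>0 \<Lambda> h\<^sub>1 \<alpha> (k, \<gamma>)" using \<gamma> by (simp add: LR_params_def R_def)
  then show ?thesis by blast
qed

lemma LR_params_unique:
  assumes fin: "finite S" "finite H\<^sub>0" "\<forall>h\<in>H\<^sub>0. set_pmf (\<pi> h) \<subseteq> S"
    and pos: "\<forall>P\<in>S. mixture \<pi> H\<^sub>0 \<Lambda> P > 0"
    and "LR_params \<pi> H\<^sub>0 \<Lambda> h\<^sub>1 \<alpha> a" "LR_params \<pi> H\<^sub>0 \<Lambda> h\<^sub>1 \<alpha> b" and "P \<in> S"
  shows "threshold_test (Ratio \<pi> H\<^sub>0 \<Lambda> h\<^sub>1) a P = threshold_test (Ratio \<pi> H\<^sub>0 \<Lambda> h\<^sub>1) b P"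
proof -
  define t where "t = threshold_test (Ratio \<pi> H\<^sub>0 \<Lambda> h\<^sub>1)"
  have *: "t a P = t b P" if ab: "LR_params \<pi> H\<^sub>0 \<Lambda> h\<^sub>1 \<alpha> a" "LR_params \<pi> H\<^sub>0 \<Lambda> h\<^sub>1 \<alpha> b"
    and le: "fst a < fst b \<or> fst a = fst b \<and> snd a \<ge> snd b" for a b
  proof -
    have ge: "t a Q \<ge> t b Q" for Q
      using ab le by (cases a; cases b) (auto simp: t_def threshold_test_def LR_params_def)
    have "(\<Sum>Q\<in>S. mixture \<pi> H\<^sub>0 \<Lambda> Q * t a Q) = (\<Sum>Q\<in>S. mixture \<pi> H\<^sub>0 \<Lambda> Q * t b Q)"
      using ab unfolding mixture_size[OF fin, symmetric]
      by (auto simp: LR_params_def t_def split: prod.splits)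
    then have "(\<Sum>Q\<in>S. mixture \<pi> H\<^sub>0 \<Lambda> Q * (t a Q - t b Q)) = 0"
      by (simp add: right_diff_distrib sum_subtractf)
    then have "\<forall>Q\<in>S. mixture \<pi> H\<^sub>0 \<Lambda> Q * (t a Q - t b Q) = 0"
      using fin pos ge by (subst (asm) sum_nonneg_eq_0_iff) (auto intro: less_imp_le)
    then show ?thesis using pos \<open>P \<in> S\<close> by force
  qed
  show ?thesis
    using *[of a b] *[of b a] assms(5,6) unfolding t_def by linarith
qed

end

theory Submission
  imports Defs
begin

text \<open>
  Two ideas carry the equivalence. The first is the Neyman-Pearson argument: the likelihood
  ratio test rejects where \<open>\<pi>\<^sub>h\<^sub>1 - k m\<close> is positive and accepts where it is negative, \<open>m\<close>
  being the \<open>\<Lambda>\<close>-mixture, so no power is lost against any test whose average size under \<open>m\<close>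
  is at most \<open>\<alpha>\<close>. Since its own average size is \<open>\<alpha>\<close>, being a most powerful test of level \<open>\<alpha>\<close>
  amounts to having size exactly \<open>\<alpha>\<close> on the support of \<open>\<Lambda>\<close> and at most \<open>\<alpha>\<close> on all of \<open>H\<^sub>0\<close>
  (\<open>least_favorable_iff_size\<close>).

  The second idea is that the sizes of threshold tests and the upper tails of the ratio
  determine each other. The test with cutoff \<open>k\<close> and randomization \<open>\<gamma>\<close> has as its size
  the convex combination, with weights \<open>1 - \<gamma>\<close> and \<open>\<gamma>\<close>, of the probabilities of \<open>R > k\<close> and
  \<open>R \<ge> k\<close>, and on a finite sample space a strict tail is a weak tail for another cutoff.
  Hence dominance makes the size under any \<open>h\<^sub>0'\<close> in the support at least the size under any
  \<open>h\<^sub>0\<close>. Two elements of the support therefore give the same size, which must equal the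
  average \<open>\<alpha>\<close>, and every other size is at most \<open>\<alpha>\<close>. Conversely, the indicator of \<open>R \<ge> c\<close>
  is itself the likelihood ratio test whose level \<open>\<alpha>\<close> is the mixture probability of \<open>R \<ge> c\<close>.
  At this level the two size conditions compare the tails: \<open>\<alpha>\<close> on the support, at most \<open>\<alpha>\<close>
  elsewhere. The levels \<open>0\<close> and \<open>1\<close> are trivial because the mixture charges every sample point.
\<close>

section \<open>Averages, tails and sizes\<close>

lemma weighted_average_attained:
  fixes x :: "'a \<Rightarrow> real"
  assumes "finite A" "set_pmf p \<subseteq> A"
    and avg: "(\<Sum>a\<in>A. pmf p a * x a) = v"
    and le: "\<And>a. a \<in> A \<Longrightarrow> x a \<le> v"
    and b: "b \<in> set_pmf p"
  shows "x b = v"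
proof -
  have "(\<Sum>a\<in>A. pmf p a * (v - x a)) = 0"
    using avg sum_pmf_eq_1[OF assms(1,2)]
    by (simp add: right_diff_distrib sum_subtractf sum_distrib_right[symmetric])
  then have "pmf p b * (v - x b) = 0"
    using assms by (subst (asm) sum_nonneg_eq_0_iff) auto
  then show ?thesis using b by (simp add: set_pmf_iff)
qed

text \<open>
  Take for \<open>c'\<close> the least value of \<open>f\<close> above \<open>c\<close>; if there is none, any cutoff beyond all the
  values of \<open>f\<close> will do. Dominance compares weak tails only, whereas a threshold test rejects
  outright on a strict one.
\<close>

lemma strict_tail_eq_weak_tail:
  fixes f :: "'a \<Rightarrow> real"
  assumes "finite S"
  obtains c' where "\<And>x. x \<in> S \<Longrightarrow> c < f x \<longleftrightarrow> c' \<le> f x"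
proof (cases "{x \<in> S. c < f x} = {}")
  case True
  then show ?thesis by (intro that[of "c + 1"]) force+
next
  case False
  define c' where "c' = Min (f ` {x \<in> S. c < f x})"
  have "c' \<in> f ` {x \<in> S. c < f x}"
    unfolding c'_def using False assms by (intro Min_in) auto
  moreover have "c' \<le> f x" if "x \<in> S" "c < f x" for x
    unfolding c'_def using that assms by (intro Min_le) auto
  ultimately show ?thesis by (intro that[of c']) force+
qed

lemma size_at_cong:
  assumes "set_pmf (\<pi> h) \<subseteq> S" "\<And>P. P \<in> S \<Longrightarrow> f P = g P"
  shows "size_at \<pi> f h = size_at \<pi> g h"
  unfolding size_at_def using assms by (intro integral_cong_AE) (auto intro!: AE_pmfI)

lemma prob_cong_on_support:
  assumes "set_pmf p \<subseteq> S" "\<And>P. P \<in> S \<Longrightarrow> A P \<longleftrightarrow> B P"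
  shows "measure (measure_pmf p) {P. A P} = measure (measure_pmf p) {P. B P}"
  using assms by (intro measure_pmf.finite_measure_eq_AE) (auto intro!: AE_pmfI)

lemma size_at_threshold_test:
  "size_at \<pi> (threshold_test R (k, \<gamma>)) h
     = (1 - \<gamma>) * measure (measure_pmf (\<pi> h)) {P. R P > k}
       + \<gamma> * measure (measure_pmf (\<pi> h)) {P. R P \<ge> k}"
proof -
  have "threshold_test R (k, \<gamma>)
      = (\<lambda>P. (1 - \<gamma>) * indicator {P. R P > k} P + \<gamma> * indicator {P. R P \<ge> k} P)"
    by (auto simp: threshold_test_def fun_eq_iff indicator_def)
  then show ?thesis
    unfolding size_at_def
    by (simp add: Bochner_Integration.integral_add measure_pmf.integrable_const_bound[of _ 1])
qed

section \<open>Likelihood ratio tests of a finite model\<close>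

locale lr_model =
  fixes S :: "'s set" and H :: "'t set" and \<pi> :: "'t \<Rightarrow> 's pmf" and h\<^sub>1 :: 't and \<Lambda> :: "'t pmf"
  assumes finS: "finite S" and finH: "finite H"
    and supp: "\<forall>h\<in>H. set_pmf (\<pi> h) \<subseteq> S" and supp1: "set_pmf (\<pi> h\<^sub>1) \<subseteq> S"
    and prior: "set_pmf \<Lambda> \<subseteq> H"
    and pos: "\<forall>P\<in>S. pmf (\<pi> h\<^sub>1) P > 0 \<and> mixture \<pi> H \<Lambda> P > 0"
begin

abbreviation "m \<equiv> mixture \<pi> H \<Lambda>"
abbreviation "R \<equiv> Ratio \<pi> H \<Lambda> h\<^sub>1"

lemma Ratio_pos: "P \<in> S \<Longrightarrow> R P > 0"
  using pos by (simp add: Ratio_def)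

lemma mixture_size_eq:
  "(\<Sum>h\<in>H. pmf \<Lambda> h * size_at \<pi> f h) = (\<Sum>P\<in>S. m P * f P)"
  by (rule mixture_size[OF finS finH supp])

lemma LR_params_of_LR:
  assumes "0 < \<alpha>" "\<alpha> < 1"
  obtains k \<gamma> where "LR_params \<pi> H \<Lambda> h\<^sub>1 \<alpha> (k, \<gamma>)" "LR \<pi> H \<Lambda> h\<^sub>1 \<alpha> = threshold_test R (k, \<gamma>)"
proof -
  have "LR_params \<pi> H \<Lambda> h\<^sub>1 \<alpha> (SOME k\<gamma>. LR_params \<pi> H \<Lambda> h\<^sub>1 \<alpha> k\<gamma>)"
    using LR_params_exist[OF finS finH supp prior pos assms] by (rule someI_ex)
  then show ?thesis
    using that[of "fst (SOME k\<gamma>. LR_params \<pi> H \<Lambda> h\<^sub>1 \<alpha> k\<gamma>)"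
                  "snd (SOME k\<gamma>. LR_params \<pi> H \<Lambda> h\<^sub>1 \<alpha> k\<gamma>)"]
    by (simp add: LR_def)
qed

section \<open>Least favorable distributions by size\<close>

text \<open>
  The Neyman-Pearson lemma for the simple null hypothesis \<open>m\<close>. At each sample point the
  difference \<open>T - g\<close> never has the sign opposite to \<open>\<pi>\<^sub>h\<^sub>1 - k m\<close>, because \<open>T\<close> takes the extreme value \<open>1\<close> or \<open>0\<close>
  wherever \<open>R \<noteq> k\<close>. Summing the product bounds the difference of powers below by \<open>k\<close> times
  the difference of the average sizes.
\<close>

lemma neyman_pearson:
  assumes "k \<ge> 0" and g: "is_test S g"
    and size: "(\<Sum>P\<in>S. m P * g P) \<le> (\<Sum>P\<in>S. m P * threshold_test R (k, \<gamma>) P)"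
  shows "power_at \<pi> g h\<^sub>1 \<le> power_at \<pi> (threshold_test R (k, \<gamma>)) h\<^sub>1"
proof -
  define T where "T = threshold_test R (k, \<gamma>)"
  have power: "power_at \<pi> f h\<^sub>1 = (\<Sum>P\<in>S. f P * pmf (\<pi> h\<^sub>1) P)" for f
    unfolding power_at_def using finS supp1 by (intro integral_measure_pmf_real) auto
  have "0 \<le> (T P - g P) * (pmf (\<pi> h\<^sub>1) P - k * m P)" if P: "P \<in> S" for P
  proof -
    have mP: "m P > 0" and gP: "0 \<le> g P" "g P \<le> 1" using P pos g by (auto simp: is_test_def)
    consider "R P > k" | "R P < k" | "R P = k" by linarith
    then show ?thesis
    proof cases
      case 1
      then have "pmf (\<pi> h\<^sub>1) P - k * m P \<ge> 0" using mP by (simp add: Ratio_def field_simps)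
      then show ?thesis using 1 gP by (simp add: T_def threshold_test_def)
    next
      case 2
      then have "pmf (\<pi> h\<^sub>1) P - k * m P \<le> 0" using mP by (simp add: Ratio_def field_simps)
      then show ?thesis using 2 gP by (simp add: T_def threshold_test_def mult_nonneg_nonpos)
    next
      case 3
      then have "pmf (\<pi> h\<^sub>1) P - k * m P = 0" using mP by (simp add: Ratio_def field_simps)
      then show ?thesis by simp
    qed
  qed
  then have "0 \<le> (\<Sum>P\<in>S. (T P - g P) * (pmf (\<pi> h\<^sub>1) P - k * m P))" by (rule sum_nonneg)
  also have "\<dots> = power_at \<pi> T h\<^sub>1 - power_at \<pi> g h\<^sub>1
      - k * ((\<Sum>P\<in>S. m P * T P) - (\<Sum>P\<in>S. m P * g P))"
    by (simp add: power algebra_simps sum.distrib sum_subtractf sum_distrib_left)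
  finally show ?thesis
    using mult_nonneg_nonneg[of k "(\<Sum>P\<in>S. m P * T P) - (\<Sum>P\<in>S. m P * g P)"] assms(1) size
    unfolding T_def by linarith
qed

text \<open>
  A size of \<open>\<alpha>\<close> bounds every \<open>size_at\<close> by \<open>\<alpha>\<close>, and since their \<open>\<Lambda>\<close>-average is \<open>\<alpha>\<close> they attain it
  on the support. In the other direction, a competitor of size at most \<open>\<alpha>\<close> has average size
  at most \<open>\<alpha>\<close>, so the Neyman-Pearson lemma applies to it.
\<close>

lemma least_favorable_iff_size:
  assumes "0 < \<alpha>" "\<alpha> < 1"
  shows "least_favorable S \<pi> H h\<^sub>1 \<alpha> \<Lambda> \<longleftrightarrow>
    (\<forall>h\<in>set_pmf \<Lambda>. size_at \<pi> (LR \<pi> H \<Lambda> h\<^sub>1 \<alpha>) h = \<alpha>) \<and>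
    (\<forall>h\<in>H. size_at \<pi> (LR \<pi> H \<Lambda> h\<^sub>1 \<alpha>) h \<le> \<alpha>)" (is "_ \<longleftrightarrow> ?sizes")
proof -
  obtain k \<gamma> where par: "LR_params \<pi> H \<Lambda> h\<^sub>1 \<alpha> (k, \<gamma>)"
      and LR: "LR \<pi> H \<Lambda> h\<^sub>1 \<alpha> = threshold_test R (k, \<gamma>)"
    using LR_params_of_LR[OF assms] .
  define T where "T = threshold_test R (k, \<gamma>)"
  have k: "k \<ge> 0" and \<gamma>: "\<gamma> \<in> {0..1}" and avg: "(\<Sum>h\<in>H. pmf \<Lambda> h * size_at \<pi> T h) = \<alpha>"
    using par by (auto simp: LR_params_def T_def)
  have size_le: "size_at \<pi> f h \<le> test_size \<pi> H f" if "h \<in> H" for f h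
    unfolding test_size_def using that finH by (intro cSUP_upper) auto
  have "most_powerful S \<pi> H h\<^sub>1 \<alpha> T \<longleftrightarrow>
    (\<forall>h\<in>set_pmf \<Lambda>. size_at \<pi> T h = \<alpha>) \<and> (\<forall>h\<in>H. size_at \<pi> T h \<le> \<alpha>)"
  proof (intro iffI conjI ballI)
    assume mp: "most_powerful S \<pi> H h\<^sub>1 \<alpha> T"
    show le: "size_at \<pi> T h \<le> \<alpha>" if "h \<in> H" for h
      using mp size_le[OF that, of T] by (simp add: most_powerful_def)
    show "size_at \<pi> T h = \<alpha>" if "h \<in> set_pmf \<Lambda>" for h
      using weighted_average_attained[OF finH prior avg le that] .
  next
    assume *: "(\<forall>h\<in>set_pmf \<Lambda>. size_at \<pi> T h = \<alpha>) \<and> (\<forall>h\<in>H. size_at \<pi> T h \<le> \<alpha>)"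
    obtain b where b: "b \<in> set_pmf \<Lambda>" using set_pmf_not_empty by fast
    have "test_size \<pi> H T \<le> \<alpha>"
      unfolding test_size_def using * b prior by (intro cSUP_least) auto
    moreover have "\<alpha> \<le> test_size \<pi> H T" using size_le[of b T] b prior * by auto
    moreover have "is_test S T"
      using \<gamma> by (auto simp: is_test_def T_def threshold_test_def)
    moreover have "power_at \<pi> g h\<^sub>1 \<le> power_at \<pi> T h\<^sub>1"
      if g: "is_test S g" "test_size \<pi> H g \<le> \<alpha>" for g
    proof -
      have "(\<Sum>h\<in>H. pmf \<Lambda> h * size_at \<pi> g h) \<le> (\<Sum>h\<in>H. pmf \<Lambda> h * \<alpha>)"
        using size_le[of _ g] g(2) by (intro sum_mono mult_left_mono) (auto intro: order_trans)
      also have "\<dots> = \<alpha>"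
        using sum_pmf_eq_1[OF finH prior] by (simp add: sum_distrib_right[symmetric])
      finally show ?thesis
        using avg g(1) k unfolding T_def by (intro neyman_pearson) (simp_all add: mixture_size_eq)
    qed
    ultimately show "most_powerful S \<pi> H h\<^sub>1 \<alpha> T" by (simp add: most_powerful_def)
  qed
  then show ?thesis by (simp add: least_favorable_def LR T_def)
qed

section \<open>Dominance of the log-likelihood ratio\<close>

lemma weakly_dominates_iff_tails:
  assumes "h' \<in> H" "h \<in> H"
  shows "weakly_dominates (measure_pmf (\<pi> h')) (log_ratio \<pi> H \<Lambda> h\<^sub>1)
                          (measure_pmf (\<pi> h)) (log_ratio \<pi> H \<Lambda> h\<^sub>1) \<longleftrightarrow>
    (\<forall>c. measure (measure_pmf (\<pi> h)) {P. R P \<ge> c} \<le> measure (measure_pmf (\<pi> h')) {P. R P \<ge> c})"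
    (is "?D \<longleftrightarrow> ?T")
proof -
  have log_tail: "measure (measure_pmf (\<pi> g)) {P. log_ratio \<pi> H \<Lambda> h\<^sub>1 P \<ge> p}
      = measure (measure_pmf (\<pi> g)) {P. R P \<ge> exp p}" if "g \<in> H" for g p
    using that supp by (intro prob_cong_on_support[of _ S]) (auto simp: log_ratio_def Ratio_pos ln_ge_iff)
  have D: "?D \<longleftrightarrow> (\<forall>p. measure (measure_pmf (\<pi> h)) {P. R P \<ge> exp p}
      \<le> measure (measure_pmf (\<pi> h')) {P. R P \<ge> exp p})"
    using assms by (simp add: weakly_dominates_def log_tail)
  show ?thesis
  proof
    assume ?D
    show ?T
    proof
      fix c
      show "measure (measure_pmf (\<pi> h)) {P. R P \<ge> c} \<le> measure (measure_pmf (\<pi> h')) {P. R P \<ge> c}"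
      proof (cases "c > 0")
        case True
        then have "exp (ln c) = c" by simp
        with \<open>?D\<close> D show ?thesis by metis
      next
        (* No exponential reaches a nonpositive cutoff, but such tails are the whole sample space. *)
        case False
        then have "measure (measure_pmf (\<pi> g)) {P. R P \<ge> c} = measure (measure_pmf (\<pi> g)) {P. True}"
          if "g \<in> H" for g
          using that supp by (intro prob_cong_on_support[of _ S]) (auto dest!: Ratio_pos)
        then show ?thesis using assms by simp
      qed
    qed
  qed (simp add: D)
qed

text \<open>
  The size is a convex combination of a strict and a weak tail, and on \<open>S\<close> the strict tail is
  the weak tail at the next cutoff. That cutoff depends on the ratio alone, hence serves both
  \<open>h\<close> and \<open>h'\<close>.
\<close>

lemma size_le_of_tails_le:
  assumes "h \<in> H" "h' \<in> H" "\<gamma> \<in> {0..1}"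
    and tails: "\<And>c. measure (measure_pmf (\<pi> h)) {P. R P \<ge> c}
                      \<le> measure (measure_pmf (\<pi> h')) {P. R P \<ge> c}"
  shows "size_at \<pi> (threshold_test R (k, \<gamma>)) h \<le> size_at \<pi> (threshold_test R (k, \<gamma>)) h'"
proof -
  obtain c where c: "\<And>P. P \<in> S \<Longrightarrow> k < R P \<longleftrightarrow> c \<le> R P"
    using strict_tail_eq_weak_tail[OF finS, of k R] by metis
  have "measure (measure_pmf (\<pi> g)) {P. R P > k} = measure (measure_pmf (\<pi> g)) {P. R P \<ge> c}"
    if "g \<in> H" for g
    using that supp c by (intro prob_cong_on_support[of _ S]) auto
  then show ?thesis
    using assms by (auto simp: size_at_threshold_test intro!: add_mono mult_left_mono)
qed

text \<open>
  The tail event \<open>R \<ge> c\<close> is the rejection region of the threshold test with cutoff \<open>c\<close> and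
  \<open>\<gamma> = 1\<close>, so it coincides on \<open>S\<close> with the likelihood ratio test at the level \<open>\<alpha>\<close> given by its
  own mixture probability.
\<close>

lemma tails_le_of_uniformly_least_favorable:
  assumes ulf: "uniformly_least_favorable S \<pi> H h\<^sub>1 \<Lambda>"
    and h': "h' \<in> set_pmf \<Lambda>" and h: "h \<in> H"
  shows "measure (measure_pmf (\<pi> h)) {P. R P \<ge> c} \<le> measure (measure_pmf (\<pi> h')) {P. R P \<ge> c}"
proof -
  define T where "T = threshold_test R (c, 1)"
  define \<alpha> where "\<alpha> = (\<Sum>P\<in>S. m P * T P)"
  have h'H: "h' \<in> H" using h' prior by auto
  have T01: "T P = (if R P \<ge> c then 1 else 0)" for P by (auto simp: T_def threshold_test_def)
  have m1: "(\<Sum>P\<in>S. m P) = 1" using sum_mixture[OF finS finH supp prior] .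
  have \<alpha>0: "\<alpha> \<ge> 0" unfolding \<alpha>_def using pos by (intro sum_nonneg) (auto simp: T01 less_imp_le)
  have \<alpha>1: "\<alpha> \<le> 1"
    unfolding \<alpha>_def m1[symmetric] using pos by (intro sum_mono) (auto simp: T01 less_imp_le)
  have size_T: "size_at \<pi> T g = measure (measure_pmf (\<pi> g)) {P. R P \<ge> c}" for g
    by (simp add: T_def size_at_threshold_test)
  consider "\<alpha> = 0" | "\<alpha> = 1" | "0 < \<alpha>" "\<alpha> < 1" using \<alpha>0 \<alpha>1 by linarith
  then show ?thesis
  proof cases
    case 1
    then have "\<forall>P\<in>S. m P * T P = 0"
      unfolding \<alpha>_def using finS pos
      by (subst (asm) sum_nonneg_eq_0_iff) (auto simp: T01 less_imp_le)
    then have "\<not> R P \<ge> c" if "P \<in> S" for P using that pos by (force simp: T01)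
    then have "measure (measure_pmf (\<pi> h)) {P. R P \<ge> c} = measure (measure_pmf (\<pi> h)) {P. False}"
      using supp h by (intro prob_cong_on_support[of _ S]) auto
    then show ?thesis by simp
  next
    case 2
    then have "(\<Sum>P\<in>S. m P * (1 - T P)) = 0"
      using m1 by (simp add: \<alpha>_def right_diff_distrib sum_subtractf)
    then have "\<forall>P\<in>S. m P * (1 - T P) = 0"
      using finS pos by (subst (asm) sum_nonneg_eq_0_iff) (auto simp: T01 less_imp_le)
    then have "R P \<ge> c" if "P \<in> S" for P using that pos by (force simp: T01 split: if_splits)
    then have "measure (measure_pmf (\<pi> h')) {P. R P \<ge> c} = measure (measure_pmf (\<pi> h')) {P. True}"
      using supp h'H by (intro prob_cong_on_support[of _ S]) auto
    then show ?thesis by simp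
  next
    case 3
    obtain k \<gamma> where par: "LR_params \<pi> H \<Lambda> h\<^sub>1 \<alpha> (k, \<gamma>)"
        and LR: "LR \<pi> H \<Lambda> h\<^sub>1 \<alpha> = threshold_test R (k, \<gamma>)"
      using LR_params_of_LR[OF 3] .
    (* A likelihood ratio test needs a nonnegative cutoff; a negative c would give level 1. *)
    have "c \<ge> 0"
    proof (rule ccontr)
      assume "\<not> c \<ge> 0"
      then have "\<alpha> = (\<Sum>P\<in>S. m P)"
        unfolding \<alpha>_def by (intro sum.cong) (auto simp: T01 dest!: Ratio_pos)
      then show False using 3 m1 by simp
    qed
    then have "LR_params \<pi> H \<Lambda> h\<^sub>1 \<alpha> (c, 1)"
      by (simp add: LR_params_def mixture_size_eq \<alpha>_def T_def)
    then have eq: "LR \<pi> H \<Lambda> h\<^sub>1 \<alpha> P = T P" if "P \<in> S" for P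
      unfolding LR T_def using LR_params_unique[OF finS finH supp _ par _ that] pos by blast
    have size_LR: "size_at \<pi> (LR \<pi> H \<Lambda> h\<^sub>1 \<alpha>) g = measure (measure_pmf (\<pi> g)) {P. R P \<ge> c}"
      if "g \<in> H" for g
      unfolding size_T[symmetric] using that supp eq by (intro size_at_cong[of _ _ S]) auto
    have "least_favorable S \<pi> H h\<^sub>1 \<alpha> \<Lambda>"
      using ulf 3 by (simp add: uniformly_least_favorable_def)
    then show ?thesis
      using least_favorable_iff_size[OF 3] h h' size_LR[OF h] size_LR[OF h'H] by auto
  qed
qed

lemma least_favorable_of_tails_le:
  assumes tails: "\<And>h' h c. h' \<in> set_pmf \<Lambda> \<Longrightarrow> h \<in> H \<Longrightarrow>
      measure (measure_pmf (\<pi> h)) {P. R P \<ge> c} \<le> measure (measure_pmf (\<pi> h')) {P. R P \<ge> c}"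
    and \<alpha>: "0 < \<alpha>" "\<alpha> < 1"
  shows "least_favorable S \<pi> H h\<^sub>1 \<alpha> \<Lambda>"
proof -
  obtain k \<gamma> where par: "LR_params \<pi> H \<Lambda> h\<^sub>1 \<alpha> (k, \<gamma>)"
      and LR: "LR \<pi> H \<Lambda> h\<^sub>1 \<alpha> = threshold_test R (k, \<gamma>)"
    using LR_params_of_LR[OF \<alpha>] .
  define T where "T = threshold_test R (k, \<gamma>)"
  have avg: "(\<Sum>h\<in>H. pmf \<Lambda> h * size_at \<pi> T h) = \<alpha>" and \<gamma>: "\<gamma> \<in> {0..1}"
    using par by (auto simp: LR_params_def T_def)
  have le: "size_at \<pi> T h \<le> size_at \<pi> T h'" if "h' \<in> set_pmf \<Lambda>" "h \<in> H" for h h'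
    unfolding T_def using that prior \<gamma> tails by (intro size_le_of_tails_le) auto
  have supp_eq: "size_at \<pi> T b = \<alpha>" if b: "b \<in> set_pmf \<Lambda>" for b
  proof -
    (* All sizes on the support agree with the one at b, so the average is that size. *)
    have "pmf \<Lambda> h * size_at \<pi> T h = pmf \<Lambda> h * size_at \<pi> T b" if "h \<in> H" for h
      using le[of b h] le[of h b] b that prior by (cases "h \<in> set_pmf \<Lambda>") (auto simp: set_pmf_iff)
    then have "\<alpha> = (\<Sum>h\<in>H. pmf \<Lambda> h * size_at \<pi> T b)"
      unfolding avg[symmetric] by (intro sum.cong) auto
    also have "\<dots> = size_at \<pi> T b"
      using sum_pmf_eq_1[OF finH prior] by (simp add: sum_distrib_right[symmetric])
    finally show ?thesis by simp
  qed
  moreover have "size_at \<pi> T h \<le> \<alpha>" if "h \<in> H" for h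
  proof -
    obtain b where "b \<in> set_pmf \<Lambda>" using set_pmf_not_empty by fast
    then show ?thesis using le[of b h] supp_eq that by auto
  qed
  ultimately show ?thesis
    using least_favorable_iff_size[OF \<alpha>] by (simp add: LR T_def)
qed

end

theorem lemma3:
  fixes S :: "'s set" and \<Theta> H\<^sub>0 :: "'t set" and \<pi> :: "'t \<Rightarrow> 's pmf"
    and h\<^sub>1 :: 't and \<Lambda> :: "'t pmf"
  assumes "finite_statistical_model S \<Theta> \<pi>"
    and "H\<^sub>0 \<subseteq> \<Theta>" and "h\<^sub>1 \<in> \<Theta> - H\<^sub>0"
    and "set_pmf \<Lambda> \<subseteq> H\<^sub>0"
    and "\<forall>P\<in>S. pmf (\<pi> h\<^sub>1) P > 0 \<and> (\<Sum>h\<^sub>0\<in>H\<^sub>0. pmf \<Lambda> h\<^sub>0 * pmf (\<pi> h\<^sub>0) P) > 0"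
  shows "uniformly_least_favorable S \<pi> H\<^sub>0 h\<^sub>1 \<Lambda> \<longleftrightarrow>
    (\<forall>h\<^sub>0'\<in>set_pmf \<Lambda>. \<forall>h\<^sub>0\<in>H\<^sub>0.
       weakly_dominates (measure_pmf (\<pi> h\<^sub>0')) (log_ratio \<pi> H\<^sub>0 \<Lambda> h\<^sub>1)
                        (measure_pmf (\<pi> h\<^sub>0)) (log_ratio \<pi> H\<^sub>0 \<Lambda> h\<^sub>1))"
proof -
  interpret lr_model S H\<^sub>0 \<pi> h\<^sub>1 \<Lambda>
    using assms by unfold_locales
      (auto simp: finite_statistical_model_def mixture_def intro: finite_subset)
  have dom_iff: "weakly_dominates (measure_pmf (\<pi> h')) (log_ratio \<pi> H\<^sub>0 \<Lambda> h\<^sub>1)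
                          (measure_pmf (\<pi> h)) (log_ratio \<pi> H\<^sub>0 \<Lambda> h\<^sub>1) \<longleftrightarrow>
      (\<forall>c. measure (measure_pmf (\<pi> h)) {P. R P \<ge> c} \<le> measure (measure_pmf (\<pi> h')) {P. R P \<ge> c})"
    if "h' \<in> set_pmf \<Lambda>" "h \<in> H\<^sub>0" for h' h
    using that assms(4) by (intro weakly_dominates_iff_tails) auto
  show ?thesis (is "_ \<longleftrightarrow> ?dominance")
  proof
    assume "uniformly_least_favorable S \<pi> H\<^sub>0 h\<^sub>1 \<Lambda>"
    then show "?dominance" using tails_le_of_uniformly_least_favorable by (simp add: dom_iff)
  next
    assume "?dominance"
    then show "uniformly_least_favorable S \<pi> H\<^sub>0 h\<^sub>1 \<Lambda>"
      unfolding uniformly_least_favorable_def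
      by (intro allI impI least_favorable_of_tails_le) (auto simp: dom_iff)
  qed
qed

end
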